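(* Let $\mathscr{S} \ni s \mapsto T_s \in \mathscr{L}(X)$ be a homomorphism of an SGT $\mathscr{S}$ into $\mathscr{L}(X)$ (where $(X,\|\cdot\|)$ is a Banach space) that is continuous in the strong operator topology of $\mathscr{L}(X)$. Further, assume $\mathscr{S}_0$ is a weakly right amenable subsemigroup of $\mathscr{S}$ (in the topology inherited from $\mathscr{S}$) such that $(\star)$ $\mathscr{S}$ is the unique subsemigroup $\mathscr{Z}$ of $\mathscr{S}$ that is closed, contains $\mathscr{S}_0$ and has the following property: if $x, y \in \mathscr{S}$ and $x, xy \in \mathscr{Z}$, then $y \in \mathscr{Z}$. If $m$ and $M$ are two positive real constants such that $$m \|u\| \leqslant \|T_s u\| \leqslant M \|u\| \qquad (u \in X,\ s \in \mathscr{S}_0),$$ then for any $s \in \mathscr{S}$ and $u \in X$, $$\frac{m}{M} \|u\| \leqslant \|T_s u\| \leqslant \frac{M}{m} \|u\|.$$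
   Context: An SGT (semigroup with topology) is a non-empty semigroup $\mathscr{S}$ that is also a (possibly non-Hausdorff) topological space; no compatibility between the multiplication and the topology is assumed. For an SGT $\mathscr{S}$, $f:\mathscr{S}\to\mathbb{R}$ and $s\in\mathscr{S}$ let $f_s(t)=f(ts)$. $C_b(\mathscr{S})$ is the space of bounded continuous real-valued functions on $\mathscr{S}$ with the sup-norm, and $C_r(\mathscr{S})=\{f\in C_b(\mathscr{S}): f_s \text{ is continuous for every } s\in\mathscr{S}\}$. Let $C_{norm}(\mathscr{S})$ be the set of all $f\in C_r(\mathscr{S})$ such that $s\mapsto f_s$ and, for all $t\in\mathscr{S}$, $s\mapsto f_{st}$ are continuous from $\mathscr{S}$ to $C_r(\mathscr{S})$ with the norm topology. $\mathscr{S}$ is weakly right amenable if there is a right invariant mean on $C_{norm}(\mathscr{S})$, i.e. a linear functional $\phi:C_{norm}(\mathscr{S})\to\mathbb{R}$ with $\inf f(\mathscr{S})\leqslant\phi(f)\leqslant\sup f(\mathscr{S})$ and $\phi(f_s)=\phi(f)$ for all $f\in C_{norm}(\mathscr{S})$, $s\in\mathscr{S}$. Banach spaces are real or complex. $\mathscr{L}(X)$ is the algebra of bounded linear operators on $X$; $s\mapsto T_s$ is a homomorphism if $T_{st}=T_sT_t$ for all $s,t$. *)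

theory Defs
  imports "HOL-Analysis.Analysis"
begin

text \<open>
  A semigroup with topology (SGT) is a type of sort {semigroup_mult, topological_space}; these two
  classes do not interact, and no separation axiom is imposed. Subsemigroups of such a type are
  nonempty subsets closed under multiplication. Taking A to be a subsemigroup with the subspace
  topology, the definitions below cover any SGT inside a given one (and the whole SGT for
  A = UNIV). A function on A is represented by an extensional function on the ambient type, so
  operations on functions on A are followed by restriction to A.
\<close>

definition subsemigroup :: "'s::semigroup_mult set \<Rightarrow> bool" where
  "subsemigroup A \<longleftrightarrow> A \<noteq> {} \<and> (\<forall>x\<in>A. \<forall>y\<in>A. x * y \<in> A)"

text \<open>Bounded continuous real functions on A; the metric is the one of the sup-norm.\<close>

definition Cb_metric ::
    "'s::topological_space set \<Rightarrow> ('s \<Rightarrow> real) metric" where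
  "Cb_metric A = cfunspace (top_of_set A) euclidean_metric"

definition Cb :: "'s::topological_space set \<Rightarrow> ('s \<Rightarrow> real) set" where
  "Cb A = mspace (Cb_metric A)"

definition right_translate ::
    "'s::semigroup_mult set \<Rightarrow> ('s \<Rightarrow> real) \<Rightarrow> 's \<Rightarrow> ('s \<Rightarrow> real)" where
  "right_translate A f s = (\<lambda>t\<in>A. f (t * s))"

definition Cr :: "'s::{semigroup_mult,topological_space} set \<Rightarrow> ('s \<Rightarrow> real) set" where
  "Cr A = {f \<in> Cb A. \<forall>s\<in>A. continuous_on A (right_translate A f s)}"

definition Cr_norm_topology ::
    "'s::{semigroup_mult,topological_space} set \<Rightarrow> ('s \<Rightarrow> real) topology" where
  "Cr_norm_topology A = mtopology_of (submetric (Cb_metric A) (Cr A))"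

definition Cnorm :: "'s::{semigroup_mult,topological_space} set \<Rightarrow> ('s \<Rightarrow> real) set" where
  "Cnorm A = {f \<in> Cr A.
     continuous_map (top_of_set A) (Cr_norm_topology A) (\<lambda>s. right_translate A f s) \<and>
     (\<forall>t\<in>A. continuous_map (top_of_set A) (Cr_norm_topology A) (\<lambda>s. right_translate A f (s * t)))}"

text \<open>
  Cnorm A is a vector space closed under right translations, so that a mean, constrained only
  on Cnorm A, is a linear functional there and its invariance makes sense.
\<close>

definition right_invariant_mean ::
    "'s::{semigroup_mult,topological_space} set \<Rightarrow> (('s \<Rightarrow> real) \<Rightarrow> real) \<Rightarrow> bool" where
  "right_invariant_mean A \<phi> \<longleftrightarrow>
     (\<forall>f\<in>Cnorm A. \<forall>g\<in>Cnorm A. \<phi> (\<lambda>t\<in>A. f t + g t) = \<phi> f + \<phi> g) \<and>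
     (\<forall>c. \<forall>f\<in>Cnorm A. \<phi> (\<lambda>t\<in>A. c * f t) = c * \<phi> f) \<and>
     (\<forall>f\<in>Cnorm A. Inf (f ` A) \<le> \<phi> f \<and> \<phi> f \<le> Sup (f ` A)) \<and>
     (\<forall>f\<in>Cnorm A. \<forall>s\<in>A. \<phi> (right_translate A f s) = \<phi> f)"

definition weakly_right_amenable ::
    "'s::{semigroup_mult,topological_space} set \<Rightarrow> bool" where
  "weakly_right_amenable A \<longleftrightarrow> (\<exists>\<phi>. right_invariant_mean A \<phi>)"

text \<open>
  Banach spaces are types of class banach, whose scalars are real. This includes complex Banach
  spaces: restricting scalars makes one a real Banach space with the same norm, and bounded
  complex-linear operators are in particular bounded real-linear, with the same composition and
  strong operator topology.
\<close>

definition operator_homomorphism ::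
    "('s::semigroup_mult \<Rightarrow> ('x::banach \<Rightarrow>\<^sub>L 'x)) \<Rightarrow> bool" where
  "operator_homomorphism T \<longleftrightarrow> (\<forall>s t. T (s * t) = T s o\<^sub>L T t)"

end

theory Submission
  imports Defs
begin

text \<open>
  The idea is to replace the norm of X by an equivalent one for which the whole semigroup acts by
  isometries. Averaging the orbit functions \<open>s \<mapsto> \<parallel>T\<^sub>s u\<parallel>\<close> over \<open>S\<^sub>0\<close> with a right invariant mean
  \<open>\<phi>\<close> gives \<open>N u = \<phi> (s \<mapsto> \<parallel>T\<^sub>s u\<parallel>)\<close>, which satisfies \<open>m \<parallel>u\<parallel> \<le> N u \<le> M \<parallel>u\<parallel>\<close> because a mean lies
  between the infimum and the supremum. The orbit function of \<open>T\<^sub>t u\<close> is the right translate by \<open>t\<close>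
  of that of \<open>u\<close>, so invariance of \<open>\<phi>\<close> says that \<open>N (T\<^sub>t u) = N u\<close> for \<open>t \<in> S\<^sub>0\<close>.

  The elements \<open>s\<close> of the whole semigroup with \<open>N (T\<^sub>s u) = N u\<close> for all \<open>u\<close> form a subsemigroup
  that contains \<open>S\<^sub>0\<close> and has the cancellation property of the hypothesis on \<open>S\<^sub>0\<close>; it is closed
  because \<open>N\<close> is Lipschitz and \<open>s \<mapsto> T\<^sub>s u\<close> is continuous. Hence it is everything, and
  \<open>m \<parallel>T\<^sub>s u\<parallel> \<le> N (T\<^sub>s u) = N u \<le> M \<parallel>u\<parallel>\<close>, and likewise from below, for every \<open>s\<close>.

  For this the orbit functions must belong to the domain of \<open>\<phi>\<close>. The uniform bound on
  \<open>\<parallel>T\<^sub>r\<parallel>\<close> for \<open>r \<in> S\<^sub>0\<close> turns the continuity of orbits into norm continuity of translations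
  (lemmas \<open>Cnorm_if_translates_controlled\<close> and \<open>orbit_norm_diff_in_Cnorm\<close>).
\<close>

lemma Cb_iff:
  "f \<in> Cb A \<longleftrightarrow> f \<in> extensional A \<and> bounded (f ` A) \<and> continuous_on A f"
  by (auto simp: Cb_def Cb_metric_def)

lemma Cb_metric_dist_le:
  assumes "0 \<le> B" "\<And>x. x \<in> A \<Longrightarrow> \<bar>f x - g x\<bar> \<le> B"
  shows "mdist (Cb_metric A) f g \<le> B"
  unfolding Cb_metric_def by (rule mdist_cfunspace_le) (use assms in \<open>auto simp: dist_real_def\<close>)

text \<open>
  The error of translation is to be measured by a continuous map \<open>h\<close> into a metric space,
  uniformly in the argument \<open>r\<close>; then sup-norm convergence of translates is convergence of \<open>h\<close>.
\<close>

lemma continuous_map_Cr_norm_topology: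
  fixes h :: "'s::{semigroup_mult,topological_space} \<Rightarrow> 'y::metric_space"
  assumes Cr: "\<And>s. s \<in> A \<Longrightarrow> F s \<in> Cr A"
    and h: "continuous_on A h" and L: "0 \<le> L"
    and le: "\<And>r s s'. r \<in> A \<Longrightarrow> s \<in> A \<Longrightarrow> s' \<in> A \<Longrightarrow> \<bar>F s r - F s' r\<bar> \<le> L * dist (h s) (h s')"
  shows "continuous_map (top_of_set A) (Cr_norm_topology A) F"
proof -
  let ?m = "submetric (Cb_metric A) (Cr A)"
  interpret Metric_space "mspace ?m" "mdist ?m"
    by (rule Metric_space_mspace_mdist)
  have mem: "F s \<in> mspace ?m" if "s \<in> A" for s
    using Cr[OF that] by (auto simp: Cr_def Cb_def)
  show ?thesis
    unfolding Cr_norm_topology_def mtopology_of_def continuous_map_to_metric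
  proof (intro ballI allI impI)
    fix s and e :: real
    assume "s \<in> topspace (top_of_set A)" and e: "e > 0"
    then have s: "s \<in> A" by simp
    define U where "U = A \<inter> h -` ball (h s) (e / (L + 1))"
    have "openin (top_of_set A) U"
      unfolding U_def by (rule continuous_openin_preimage_gen[OF h]) simp
    moreover have "s \<in> U"
      using s e L by (simp add: U_def)
    moreover have "F y \<in> mball (F s) e" if y: "y \<in> U" for y
    proof -
      have yA: "y \<in> A" and d: "dist (h s) (h y) < e / (L + 1)"
        using y by (auto simp: U_def)
      have "mdist ?m (F s) (F y) \<le> L * dist (h s) (h y)"
        using L le[OF _ s yA] by (auto intro!: Cb_metric_dist_le)
      also have "\<dots> \<le> (L + 1) * dist (h s) (h y)"
        by (simp add: mult_right_mono)
      also have "\<dots> < e"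
        using d L by (simp add: field_simps)
      finally show ?thesis
        using mem[OF s] mem[OF yA] unfolding in_mball by blast
    qed
    ultimately show "\<exists>U. openin (top_of_set A) U \<and> s \<in> U \<and> (\<forall>y\<in>U. F y \<in> mball (F s) e)"
      by blast
  qed
qed

lemma Cnorm_if_translates_controlled:
  fixes h :: "'s::{semigroup_mult,topological_space} \<Rightarrow> 'y::metric_space"
  assumes A: "subsemigroup A"
    and bd: "bounded (f ` A)" and f: "continuous_on A f"
    and ft: "\<And>t. t \<in> A \<Longrightarrow> continuous_on A (\<lambda>s. f (s * t))"
    and h: "continuous_on A h" and ht: "\<And>t. t \<in> A \<Longrightarrow> continuous_on A (\<lambda>s. h (s * t))"
    and L: "0 \<le> L"
    and le: "\<And>r s s'. r \<in> A \<Longrightarrow> s \<in> A \<Longrightarrow> s' \<in> A \<Longrightarrow>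
               \<bar>f (r * s) - f (r * s')\<bar> \<le> L * dist (h s) (h s')"
  shows "restrict f A \<in> Cnorm A"
proof -
  have mult: "x * y \<in> A" if "x \<in> A" "y \<in> A" for x y
    using A that by (auto simp: subsemigroup_def)
  have tr: "right_translate A (restrict f A) s = (\<lambda>t\<in>A. f (t * s))" if "s \<in> A" for s
    using that mult by (auto simp: right_translate_def fun_eq_iff restrict_def)
  have trCb: "(\<lambda>t\<in>A. f (t * s)) \<in> Cb A" if s: "s \<in> A" for s
  proof -
    have "(\<lambda>t. f (t * s)) ` A \<subseteq> f ` A"
      using mult s by auto
    then show ?thesis
      using bd ft[OF s] by (auto simp: Cb_iff intro: bounded_subset)
  qed
  have trCr: "right_translate A (restrict f A) s \<in> Cr A" if s: "s \<in> A" for s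
  proof -
    have "right_translate A (\<lambda>t\<in>A. f (t * s)) r = (\<lambda>t\<in>A. f (t * (r * s)))" if "r \<in> A" for r
      using that mult by (auto simp: right_translate_def fun_eq_iff restrict_def mult.assoc)
    then show ?thesis
      using trCb mult s by (simp add: tr Cr_def) (simp add: Cb_iff)
  qed
  have Cr: "restrict f A \<in> Cr A"
    using trCb bd f by (simp add: Cr_def tr) (simp add: Cb_iff)
  have "continuous_map (top_of_set A) (Cr_norm_topology A) (\<lambda>s. right_translate A (restrict f A) s)"
    by (rule continuous_map_Cr_norm_topology[OF trCr h L]) (use le in \<open>auto simp: tr\<close>)
  moreover have "continuous_map (top_of_set A) (Cr_norm_topology A)
      (\<lambda>s. right_translate A (restrict f A) (s * t))" if t: "t \<in> A" for t
    by (rule continuous_map_Cr_norm_topology[OF trCr ht L])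
      (use le mult t in \<open>auto simp: tr\<close>)
  ultimately show ?thesis
    using Cr by (simp add: Cnorm_def)
qed

text \<open>
  Differences of orbit functions are treated at once, since bounding the mean of a difference
  is what makes the averaged norm Lipschitz; \<open>v = 0\<close> gives a single orbit function.
\<close>

lemma orbit_norm_diff_in_Cnorm:
  fixes T :: "'s::{semigroup_mult,topological_space} \<Rightarrow> ('x::banach \<Rightarrow>\<^sub>L 'x)"
  assumes hom: "operator_homomorphism T"
    and cont: "\<And>u. continuous_on A (\<lambda>s. T s u)"
    and A: "subsemigroup A"
    and ub: "\<And>s u. s \<in> A \<Longrightarrow> norm (T s u) \<le> M * norm u"
  shows "(\<lambda>s\<in>A. norm (T s u) - norm (T s v)) \<in> Cnorm A"
proof -
  have T_mult: "T (s * t) w = T s (T t w)" for s t w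
    using hom by (simp add: operator_homomorphism_def)
  have lip: "\<bar>norm (T r x) - norm (T r y)\<bar> \<le> M * dist x y" if "r \<in> A" for r x y
    by (metis (no_types) blinfun.diff_right dist_norm norm_triangle_ineq3 order_trans ub[OF that])
  \<comment> \<open>A negative \<open>M\<close> is possible when X is trivial.\<close>
  define K where "K = max M 0"
  have lipK: "\<bar>norm (T r x) - norm (T r y)\<bar> \<le> K * dist x y" if "r \<in> A" for r x y
    by (rule order_trans[OF lip[OF that]]) (simp add: K_def mult_right_mono)
  show ?thesis
  proof (rule Cnorm_if_translates_controlled[where h = "\<lambda>s. (T s u, T s v)" and L = "2 * K"])
    show "bounded ((\<lambda>s. norm (T s u) - norm (T s v)) ` A)"
      using lip by (auto simp: bounded_iff)
    fix r s s' assume r: "r \<in> A"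
    let ?d = "dist (T s u, T s v) (T s' u, T s' v)"
    have "dist (T s u) (T s' u) \<le> ?d" "dist (T s v) (T s' v) \<le> ?d"
      using dist_fst_le[of "(T s u, T s v)"] dist_snd_le[of "(T s u, T s v)"] by fastforce+
    then have "K * dist (T s u) (T s' u) \<le> K * ?d" "K * dist (T s v) (T s' v) \<le> K * ?d"
      by (auto simp: K_def intro!: mult_left_mono)
    then show "\<bar>norm (T (r * s) u) - norm (T (r * s) v) - (norm (T (r * s') u) - norm (T (r * s') v))\<bar>
        \<le> 2 * K * ?d"
      using lipK[OF r, of "T s u" "T s' u"] lipK[OF r, of "T s v" "T s' v"]
      unfolding T_mult by linarith
  qed (use A in \<open>auto simp: T_mult K_def intro!: continuous_intros cont\<close>)
qed

text \<open>
  The witness is the mean of the orbit function, \<open>N u = \<phi> (s \<mapsto> \<parallel>T\<^sub>s u\<parallel>)\<close>. Of the properties of a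
  norm only the Lipschitz estimate is recorded, the part of the triangle inequality that yields
  continuity; it is the mean of the pointwise estimate \<open>\<parallel>T\<^sub>s u\<parallel> - \<parallel>T\<^sub>s v\<parallel> \<le> M \<parallel>u - v\<parallel>\<close>.
  Multiplicativity of \<open>T\<close> makes the orbit function of \<open>T\<^sub>t u\<close> a right translate, whence the invariance.
\<close>

lemma ex_invariant_averaged_norm:
  fixes T :: "'s::{semigroup_mult,topological_space} \<Rightarrow> ('x::banach \<Rightarrow>\<^sub>L 'x)"
  assumes hom: "operator_homomorphism T"
    and cont: "\<And>u. continuous_on A (\<lambda>s. T s u)"
    and A: "subsemigroup A" "weakly_right_amenable A"
    and lb: "\<And>s u. s \<in> A \<Longrightarrow> m * norm u \<le> norm (T s u)"
    and ub: "\<And>s u. s \<in> A \<Longrightarrow> norm (T s u) \<le> M * norm u"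
  obtains N :: "'x \<Rightarrow> real" where
    "\<And>u. m * norm u \<le> N u" "\<And>u. N u \<le> M * norm u"
    "\<And>u v. \<bar>N u - N v\<bar> \<le> M * norm (u - v)"
    "\<And>t u. t \<in> A \<Longrightarrow> N (T t u) = N u"
proof -
  obtain \<phi> where \<phi>: "right_invariant_mean A \<phi>"
    using A by (auto simp: weakly_right_amenable_def)
  have ne: "A \<noteq> {}" and mult: "\<And>x y. x \<in> A \<Longrightarrow> y \<in> A \<Longrightarrow> x * y \<in> A"
    using A by (auto simp: subsemigroup_def)
  define F where "F u = (\<lambda>s\<in>A. norm (T s u))" for u
  define D where "D u v = (\<lambda>s\<in>A. norm (T s u) - norm (T s v))" for u v
  have D: "D u v \<in> Cnorm A" for u v
    unfolding D_def by (rule orbit_norm_diff_in_Cnorm[OF hom cont A(1) ub])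
  have F: "F u \<in> Cnorm A" for u
    using D[of u 0] by (simp add: D_def F_def blinfun.zero_right)
  have add: "\<phi> (\<lambda>t\<in>A. f t + g t) = \<phi> f + \<phi> g" if "f \<in> Cnorm A" "g \<in> Cnorm A" for f g
    using \<phi> that by (simp add: right_invariant_mean_def)
  have inv: "\<phi> (right_translate A f s) = \<phi> f" if "f \<in> Cnorm A" "s \<in> A" for f s
    using \<phi> that by (simp add: right_invariant_mean_def)
  have le: "\<phi> f \<le> c" if "f \<in> Cnorm A" "\<And>s. s \<in> A \<Longrightarrow> f s \<le> c" for f c
  proof -
    have "\<phi> f \<le> Sup (f ` A)"
      using \<phi> that by (simp add: right_invariant_mean_def)
    also have "\<dots> \<le> c"
      using ne that by (intro cSUP_least) auto
    finally show ?thesis .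
  qed
  have ge: "c \<le> \<phi> f" if "f \<in> Cnorm A" "\<And>s. s \<in> A \<Longrightarrow> c \<le> f s" for f c
  proof -
    have "c \<le> Inf (f ` A)"
      using ne that by (intro cINF_greatest) auto
    also have "\<dots> \<le> \<phi> f"
      using \<phi> that by (simp add: right_invariant_mean_def)
    finally show ?thesis .
  qed
  show thesis
  proof (rule that[of "\<lambda>u. \<phi> (F u)"])
    show "m * norm u \<le> \<phi> (F u)" "\<phi> (F u) \<le> M * norm u" for u
      using lb ub by (intro ge le F; simp add: F_def)+
    have half: "\<phi> (F u) - \<phi> (F v) \<le> M * norm (u - v)" for u v
    proof -
      have "F u = (\<lambda>s\<in>A. F v s + D u v s)"
        by (auto simp: F_def D_def fun_eq_iff)
      then have "\<phi> (F u) = \<phi> (F v) + \<phi> (D u v)"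
        using add[OF F D] by metis
      moreover have "\<phi> (D u v) \<le> M * norm (u - v)"
      proof (rule le[OF D])
        fix s assume s: "s \<in> A"
        then have "D u v s \<le> norm (T s (u - v))"
          using norm_triangle_ineq2[of "T s u" "T s v"] by (simp add: D_def blinfun.diff_right)
        then show "D u v s \<le> M * norm (u - v)"
          using ub[OF s, of "u - v"] by linarith
      qed
      ultimately show ?thesis by simp
    qed
    show "\<bar>\<phi> (F u) - \<phi> (F v)\<bar> \<le> M * norm (u - v)" for u v
      using half[of u v] half[of v u] by (simp add: norm_minus_commute abs_le_iff)
    show "\<phi> (F (T t u)) = \<phi> (F u)" if t: "t \<in> A" for t u
    proof -
      have "F (T t u) = right_translate A (F u) t"
        using hom mult t
        by (auto simp: F_def right_translate_def fun_eq_iff operator_homomorphism_def)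
      then show ?thesis
        by (simp add: inv[OF F t])
    qed
  qed
qed

theorem corollary4p14:
  fixes T :: "'s::{semigroup_mult,topological_space} \<Rightarrow> ('x::banach \<Rightarrow>\<^sub>L 'x)"
    and S0 :: "'s set"
    and m M :: real
  assumes hom: "operator_homomorphism T"
    and cont: "continuous_map euclidean strong_operator_topology T"
    and S0: "subsemigroup S0" "weakly_right_amenable S0"
    and star: "\<And>Z. (subsemigroup Z \<and> closed Z \<and> S0 \<subseteq> Z \<and>
                      (\<forall>x y. x \<in> Z \<and> x * y \<in> Z \<longrightarrow> y \<in> Z)) \<longleftrightarrow> Z = UNIV"
    and mM: "m > 0" "M > 0"
    and bounds: "\<And>u s. s \<in> S0 \<Longrightarrow>
                   m * norm u \<le> norm (blinfun_apply (T s) u) \<and>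
                   norm (blinfun_apply (T s) u) \<le> M * norm u"
  shows "\<forall>s u. m / M * norm u \<le> norm (blinfun_apply (T s) u) \<and>
               norm (blinfun_apply (T s) u) \<le> M / m * norm u"
proof -
  have T_mult: "T (s * t) w = T s (T t w)" for s t w
    using hom by (simp add: operator_homomorphism_def)
  have T_cont: "continuous_on UNIV (\<lambda>s. T s u)" for u
    using cont by (simp add: continuous_on_strong_operator_topo_iff_coordinatewise)
  obtain N where N: "\<And>u. m * norm u \<le> N u" "\<And>u. N u \<le> M * norm u"
    and N_lip: "\<And>u v. \<bar>N u - N v\<bar> \<le> M * norm (u - v)"
    and N_inv: "\<And>t u. t \<in> S0 \<Longrightarrow> N (T t u) = N u"
    using ex_invariant_averaged_norm[OF hom continuous_on_subset[OF T_cont subset_UNIV] S0]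
      bounds by metis
  have "M-lipschitz_on UNIV N"
    by (rule lipschitz_onI) (use N_lip mM in \<open>auto simp: dist_norm\<close>)
  then have N_cont: "continuous_on UNIV N"
    by (rule lipschitz_on_continuous_on)
  define Z where "Z = {s. \<forall>u. N (T s u) = N u}"
  have S0_Z: "S0 \<subseteq> Z"
    using N_inv by (auto simp: Z_def)
  moreover have "subsemigroup Z"
    using S0(1) S0_Z by (fastforce simp: subsemigroup_def Z_def T_mult)
  moreover have "closed Z"
    unfolding Z_def
    by (intro closed_Collect_all closed_Collect_eq continuous_on_const
        continuous_on_compose2[OF N_cont T_cont]) auto
  moreover have "y \<in> Z" if "x \<in> Z" "x * y \<in> Z" for x y
    using that by (auto simp: Z_def T_mult)
  ultimately have "Z = UNIV"
    using star[of Z] by blast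
  then have N_T: "N (T s u) = N u" for s u
    by (auto simp: Z_def)
  have "m * norm u \<le> M * norm (T s u)" "m * norm (T s u) \<le> M * norm u" for s u
    using N[of u] N[of "T s u"] N_T[of s u] by linarith+
  then show ?thesis
    using mM by (auto simp: field_simps)
qed

end
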